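(* In the setting described in the context, assume that $\varphi_f$ is such that, for almost any $t\in\Gamma$: (C1) $\varphi_f(t,\cdot)$ is three times differentiable on a neighborhood of $f(t)$; (C2) $(\varphi_f(t,\cdot))'(f(t))=0$ and $(\varphi_f(t,\cdot))''(f(t))\neq0$; (C3) there exists $\tilde C$ (independent of $t$) such that, for almost all $t\in\Gamma$, there is a neighborhood $U(t)$ of $f(t)$ with $$\left|\frac{(\varphi_f(t,\cdot))'''(z)}{\big((\varphi_f(t,\cdot))''(z)\big)^3}\right|\le\tilde C\quad\text{for all }z\in U(t).$$ Assume that the following source condition holds: there exist $p^\dagger\in Y^*$, single-valued and bounded a.e., and $v^\dagger\in X$ with $A^*p^\dagger\in\partial R(u^\dagger)$ and $$\frac{p^\dagger(t)}{(\varphi_f(t,\cdot))''(f(t))}=Av^\dagger(t)\quad\text{for almost any }t\in\Gamma$$ (equivalently, $p^\dagger(t)\,\big((\varphi_f(t,\cdot))^*\big)''(0)=Av^\dagger(t)$ for almost any $t\in\Gamma$). Suppose that there exists $\zeta_\alpha^\dagger\in\partial H_f^*(-\alpha p^\dagger)$ such that $$\langle\zeta_\alpha^\dagger,p_\alpha-p^\dagger\rangle=\int_\Gamma\big((\varphi_f(t,\cdot))^*\big)'(-\alpha p^\dagger(t))\,(p_\alpha(t)-p^\dagger(t))\,dt,$$ and that there exists $C>0$ such that, for all sufficiently small $\alpha>0$, $$D^s_{H_f^*}(-\alpha p_\alpha,-\alpha p^\dagger)\ge C\alpha^2\Vert p_\alpha-p^\dagger\Vert_2^2 .$$ Then, for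 all sufficiently small $\alpha>0$, $$D_R(u_\alpha,u^\dagger)\le D_R(u^\dagger-\alpha v^\dagger,u^\dagger)+O(\alpha^3).$$
   Context: $\Gamma\subset\mathbb{R}^2$ is a bounded measurable set, $X$ is a Banach space, $Y$ is a Banach space of functions on $\Gamma$, $A:X\to Y$ is a bounded linear operator, $f\in Y$. The data fidelity is $H_f(z)=\int_\Gamma\varphi_f(t,z(t))\,dt$, where $\varphi_f:\Gamma\times\mathbb{R}\to(-\infty,+\infty]$ is proper, convex and lower semicontinuous in its second variable; derivatives and the Fenchel conjugate $(\varphi_f(t,\cdot))^*$ are taken with respect to the second variable. $H_f:Y\to\mathbb{R}\cup\{+\infty\}$ and $R:X\to\mathbb{R}\cup\{+\infty\}$ are proper, convex and lower semicontinuous. "$p^\dagger\in Y^*$ single-valued and bounded a.e." means that $p^\dagger$ is given by an a.e. bounded function on $\Gamma$ acting through $\langle z,p^\dagger\rangle=\int_\Gamma z(t)p^\dagger(t)\,dt$; likewise $p_\alpha$ below is treated as a function on $\Gamma$. $u^\dagger\in\operatorname{arg\,min}\{R(u):Au=f\}$. For each $\alpha>0$ it is assumed that a minimizer $u_\alpha$ of $\frac1\alpha H_f(Au)+R(u)$ over $X$ exists, and that there is $u_0\in\operatorname{dom}(H_f\circ A)\cap\operatorname{dom}R$ such that $H_f$ is continuous at $Au_0$. Then the dual problem of minimizing $\frac1\alpha H_f^*(-\alpha p)+R^*(A^*p)$ over $p\in Y^*$ has a solution $p_\alpha$, and $A^*p_\alpha\in\partial R(u_\alpha)$, $\zeta_\alpha:=Au_\alpha\in\partial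 H_f^*(-\alpha p_\alpha)$. $D_R(u,u^\dagger)=R(u)-R(u^\dagger)-\langle A^*p^\dagger,u-u^\dagger\rangle$. The symmetric Bregman distance is $D^s_{H_f^*}(-\alpha p_\alpha,-\alpha p^\dagger)=\langle\zeta_\alpha-\zeta_\alpha^\dagger,-\alpha p_\alpha+\alpha p^\dagger\rangle$, i.e. it is taken with respect to the subgradients $\zeta_\alpha\in\partial H_f^*(-\alpha p_\alpha)$ and $\zeta_\alpha^\dagger\in\partial H_f^*(-\alpha p^\dagger)$. $\Vert\cdot\Vert_2$ is the $L^2(\Gamma)$-norm and $O(\alpha^3)$ is understood as $\alpha\to0$.
   Formalization: Added, since the claim fails if the neighborhoods U(t) may shrink arbitrarily: there is α0>0, independent of t, such that for almost all t and all 0<α<α0 the value −αp†(t) is attained by (φ_f(t,·))' on U(t); also (φ_f(t,·))''≠0 on U(t), so that the quotient in (C3) makes sense. *)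

theory Defs
  imports "HOL-Analysis.Analysis" "HOL-Library.Landau_Symbols"
begin

section \<open>Convex analysis for extended-real-valued functions\<close>

definition proper_fun :: "('a \<Rightarrow> ereal) \<Rightarrow> bool" where
  "proper_fun g \<longleftrightarrow> (\<forall>x. g x \<noteq> -\<infinity>) \<and> (\<exists>x. g x \<noteq> \<infinity>)"

definition convex_fun :: "('a::real_vector \<Rightarrow> ereal) \<Rightarrow> bool" where
  "convex_fun g \<longleftrightarrow> (\<forall>x y. \<forall>s\<in>{0..1::real}.
     g (s *\<^sub>R x + (1 - s) *\<^sub>R y) \<le> ereal s * g x + ereal (1 - s) * g y)"

definition lsc_fun :: "('a::topological_space \<Rightarrow> ereal) \<Rightarrow> bool" where
  "lsc_fun g \<longleftrightarrow> (\<forall>x. g x \<le> Liminf (at x) g)"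

text \<open>The pairing is a parameter, so that the same definition gives the conjugate on the
  topological dual (pairing \<^const>\<open>blinfun_apply\<close>) and the conjugate of a function
  of one real variable (pairing by multiplication).\<close>

definition fenchel_conjugate :: "('q \<Rightarrow> 'a \<Rightarrow> real) \<Rightarrow> ('a \<Rightarrow> ereal) \<Rightarrow> 'q \<Rightarrow> ereal" where
  "fenchel_conjugate pair g q = (SUP x. ereal (pair q x) - g x)"

definition subdifferential ::
  "('a::real_normed_vector \<Rightarrow> ereal) \<Rightarrow> 'a \<Rightarrow> ('a \<Rightarrow>\<^sub>L real) set" where
  "subdifferential g x =
     {\<xi>. \<bar>g x\<bar> \<noteq> \<infinity> \<and> (\<forall>y. g x + ereal (blinfun_apply \<xi> (y - x)) \<le> g y)}"

definition bregman ::
  "('a::real_normed_vector \<Rightarrow> ereal) \<Rightarrow> ('a \<Rightarrow>\<^sub>L real) \<Rightarrow> 'a \<Rightarrow> 'a \<Rightarrow> ereal" where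
  "bregman g \<xi> u v = g u - g v - ereal (blinfun_apply \<xi> (u - v))"

text \<open>Symmetric Bregman distance of \<open>q1\<close> and \<open>q2\<close> with respect to the subgradients
  \<open>\<zeta>1\<close> at \<open>q1\<close> and \<open>\<zeta>2\<close> at \<open>q2\<close>; it depends on the underlying
  function only through these subgradients.\<close>

definition sym_bregman ::
  "('a::real_normed_vector \<Rightarrow>\<^sub>L real) \<Rightarrow> ('a \<Rightarrow>\<^sub>L real) \<Rightarrow> 'a \<Rightarrow> 'a \<Rightarrow> real" where
  "sym_bregman \<zeta>1 \<zeta>2 q1 q2 = blinfun_apply (\<zeta>1 - \<zeta>2) (q1 - q2)"

definition adjoint_op ::
  "('a::real_normed_vector \<Rightarrow>\<^sub>L 'b::real_normed_vector) \<Rightarrow> ('b \<Rightarrow>\<^sub>L real) \<Rightarrow> ('a \<Rightarrow>\<^sub>L real)" where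
  "adjoint_op A p = p o\<^sub>L A"

text \<open>Subgradients of a function on the dual space live in the bidual; elements of the space
  are subgradients through the canonical embedding.\<close>

definition bidual_embed ::
  "'a::real_normed_vector \<Rightarrow> (('a \<Rightarrow>\<^sub>L real) \<Rightarrow>\<^sub>L real)" where
  "bidual_embed y = Blinfun (\<lambda>p. blinfun_apply p y)"


section \<open>Derivatives of extended-real-valued functions of one real variable\<close>

definition ederiv :: "nat \<Rightarrow> (real \<Rightarrow> ereal) \<Rightarrow> real \<Rightarrow> real" where
  "ederiv n g = (deriv ^^ n) (\<lambda>z. real_of_ereal (g z))"

text \<open>Intended for open \<open>S\<close>.\<close>

definition times_differentiable_on :: "nat \<Rightarrow> (real \<Rightarrow> ereal) \<Rightarrow> real set \<Rightarrow> bool" where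
  "times_differentiable_on n g S \<longleftrightarrow>
     (\<forall>z\<in>S. \<bar>g z\<bar> \<noteq> \<infinity> \<and> (\<forall>k<n. ederiv k g field_differentiable (at z)))"


section \<open>Function spaces and integral functionals over a planar domain\<close>

text \<open>The elements of a Banach space of functions on \<open>\<Gamma>\<close> are abstract points of a
  type; \<open>ev y\<close> is a representative of \<open>y\<close>. Linearity is required only almost
  everywhere, so that spaces of equivalence classes such as \<open>L\<^sup>2(\<Gamma>)\<close> are included.
  The values of \<open>ev y\<close> outside \<open>\<Gamma>\<close> are irrelevant.\<close>

definition function_space ::
  "(real^2) set \<Rightarrow> ('y::real_normed_vector \<Rightarrow> real^2 \<Rightarrow> real) \<Rightarrow> bool" where
  "function_space \<Gamma> ev \<longleftrightarrow>
     (\<forall>y. ev y \<in> borel_measurable (lebesgue_on \<Gamma>)) \<and>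
     (\<forall>y z a b. AE t in lebesgue_on \<Gamma>. ev (a *\<^sub>R y + b *\<^sub>R z) t = a * ev y t + b * ev z t) \<and>
     inj (\<lambda>y. restrict (ev y) \<Gamma>)"

text \<open>The functional \<open>P\<close> is the function \<open>p\<close>, acting by integration.\<close>

definition represented_by ::
  "(real^2) set \<Rightarrow> ('y::real_normed_vector \<Rightarrow> real^2 \<Rightarrow> real) \<Rightarrow> ('y \<Rightarrow>\<^sub>L real) \<Rightarrow> (real^2 \<Rightarrow> real) \<Rightarrow> bool"
where
  "represented_by \<Gamma> ev P p \<longleftrightarrow>
     p \<in> borel_measurable (lebesgue_on \<Gamma>) \<and>
     (\<forall>z. integrable (lebesgue_on \<Gamma>) (\<lambda>t. ev z t * p t) \<and>
          blinfun_apply P z = (LINT t|lebesgue_on \<Gamma>. ev z t * p t))"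

text \<open>Integral of an extended-real-valued function; it is \<open>+\<infinity>\<close> whenever the positive
  part has infinite integral, also if the negative part has (\<open>\<infinity> - \<infinity> = \<infinity>\<close> in
  \<^typ>\<open>ereal\<close>).\<close>

definition ext_integral :: "'a measure \<Rightarrow> ('a \<Rightarrow> ereal) \<Rightarrow> ereal" where
  "ext_integral M g =
     enn2ereal (\<integral>\<^sup>+ t. e2ennreal (g t) \<partial>M) - enn2ereal (\<integral>\<^sup>+ t. e2ennreal (- g t) \<partial>M)"

definition data_fidelity ::
  "(real^2) set \<Rightarrow> ('y \<Rightarrow> real^2 \<Rightarrow> real) \<Rightarrow> (real^2 \<Rightarrow> real \<Rightarrow> ereal) \<Rightarrow> 'y \<Rightarrow> ereal" where
  "data_fidelity \<Gamma> ev \<phi> z = ext_integral (lebesgue_on \<Gamma>) (\<lambda>t. \<phi> t (ev z t))"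

text \<open>Square of the \<open>L\<^sup>2\<close> norm, infinite for functions that are not square integrable.\<close>

definition L2_norm_sq :: "(real^2) set \<Rightarrow> (real^2 \<Rightarrow> real) \<Rightarrow> ereal" where
  "L2_norm_sq \<Gamma> g = enn2ereal (\<integral>\<^sup>+ t. ennreal ((g t)\<^sup>2) \<partial>lebesgue_on \<Gamma>)"


section \<open>The variational problem and its dual\<close>

definition primal_objective ::
  "('y::real_normed_vector \<Rightarrow> ereal) \<Rightarrow> ('x::real_normed_vector \<Rightarrow> ereal) \<Rightarrow> ('x \<Rightarrow>\<^sub>L 'y) \<Rightarrow> real \<Rightarrow> 'x \<Rightarrow> ereal"
where
  "primal_objective H R A \<alpha> u = ereal (1 / \<alpha>) * H (blinfun_apply A u) + R u"

definition dual_objective ::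
  "('y::real_normed_vector \<Rightarrow> ereal) \<Rightarrow> ('x::real_normed_vector \<Rightarrow> ereal) \<Rightarrow> ('x \<Rightarrow>\<^sub>L 'y) \<Rightarrow> real \<Rightarrow> ('y \<Rightarrow>\<^sub>L real) \<Rightarrow> ereal"
where
  "dual_objective H R A \<alpha> p =
     ereal (1 / \<alpha>) * fenchel_conjugate blinfun_apply H (- \<alpha> *\<^sub>R p)
       + fenchel_conjugate blinfun_apply R (adjoint_op A p)"

end

theory Submission
  imports Defs
begin

text \<open>
  Write \<open>w = p\<^sub>\<alpha> - p\<^sup>\<dagger>\<close>. If \<open>A\<^sup>* p\<^sub>\<alpha>\<close> is a subgradient of \<open>R\<close> at \<open>u\<^sub>\<alpha>\<close>, then comparing
  \<open>R (u\<^sub>\<alpha>)\<close> with the value of \<open>R\<close> at the competitor \<open>u\<^sup>\<dagger> - \<alpha> v\<^sup>\<dagger>\<close> bounds the difference of the two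
  Bregman distances by
  \<open>\<langle>w, A u\<^sub>\<alpha> - f + \<alpha> A v\<^sup>\<dagger>\<rangle> = \<langle>w, A u\<^sub>\<alpha> - \<zeta>\<^sup>\<dagger>\<^sub>\<alpha>\<rangle> + \<langle>w, \<zeta>\<^sup>\<dagger>\<^sub>\<alpha> - f + \<alpha> A v\<^sup>\<dagger>\<rangle>\<close>.
  The first term is \<open>-1/\<alpha>\<close> times the symmetric Bregman distance, hence at most
  \<open>- C \<alpha> \<parallel>w\<parallel>\<^sup>2\<close> in \<open>L\<^sup>2\<close>. In the second term \<open>\<zeta>\<^sup>\<dagger>\<^sub>\<alpha>\<close> acts as the derivative of the pointwise
  conjugate \<open>\<phi>\<^sup>*\<close> at \<open>- \<alpha> p\<^sup>\<dagger>\<close>. That derivative is the inverse function of \<open>\<phi>'\<close>; its value at \<open>0\<close>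
  is \<open>f\<close>, its slope there is \<open>1 / \<phi>''(f)\<close>, and its second derivative is \<open>- \<phi>''' / (\<phi>'')\<^sup>3\<close>. The
  source condition says precisely that \<open>f - \<alpha> A v\<^sup>\<dagger>\<close> is its first order Taylor polynomial, so the
  bound on \<open>\<phi>''' / (\<phi>'')\<^sup>3\<close> leaves a remainder of size \<open>K \<alpha>\<^sup>2\<close>, uniformly in \<open>t\<close>
  (\<open>conjugate_deriv_taylor\<close>). Young's inequality \<open>K \<alpha>\<^sup>2 \<bar>w\<bar> \<le> C \<alpha> w\<^sup>2 + K\<^sup>2 \<alpha>\<^sup>3 / (4 C)\<close>, integrated over
  \<open>\<Gamma>\<close>, cancels the coercive first term and leaves \<open>O(\<alpha>\<^sup>3)\<close>.

  That every dual minimizer yields such a subgradient is the absence of a duality gap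
  (\<open>dual_minimizer_subgradient\<close>). It needs one application of the Hahn--Banach theorem: the values
  of the perturbed primal problem form a convex set in \<open>Y \<times> \<real>\<close>. Continuity of \<open>H\<close> at one feasible
  point bounds these values above near \<open>0\<close>, and the slope of an affine minorant through the minimum
  is, up to sign, a dual point that attains the primal value (\<open>convex_set_affine_minorant\<close>,
  \<open>dual_attains_primal_minimum\<close>).
\<close>

section \<open>Dominated linear functionals\<close>

text \<open>Only positive factors enter, and the value at \<open>0\<close> is then forced to be \<open>0\<close>.\<close>

definition sublinear :: "('a::real_vector \<Rightarrow> real) \<Rightarrow> bool" where
  "sublinear q \<longleftrightarrow>
     (\<forall>x y. q (x + y) \<le> q x + q y) \<and> (\<forall>c x. c > 0 \<longrightarrow> q (c *\<^sub>R x) = c * q x)"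

lemma sublinear_add: "sublinear q \<Longrightarrow> q (x + y) \<le> q x + q y"
  and sublinear_scaleR: "sublinear q \<Longrightarrow> c > 0 \<Longrightarrow> q (c *\<^sub>R x) = c * q x"
  by (auto simp: sublinear_def)

lemma sublinear_zero: "sublinear q \<Longrightarrow> q 0 = 0"
  using sublinear_scaleR[of q 2 0] by simp

lemma sublinear_uminus: "sublinear q \<Longrightarrow> - q (- x) \<le> q x"
  using sublinear_add[of q x "- x"] sublinear_zero[of q] by simp

text \<open>Subadditivity survives the infimum because two members of a chain always have a smaller
  one among them, which can be tested at both summands at once.\<close>

lemma sublinear_Inf_chain:
  assumes C: "C \<noteq> {}" "\<And>q. q \<in> C \<Longrightarrow> sublinear q"
    and chain: "\<And>q r. q \<in> C \<Longrightarrow> r \<in> C \<Longrightarrow> q \<le> r \<or> r \<le> q"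
    and bdd: "\<And>x. bdd_below ((\<lambda>q. q x) ` C)"
  shows "sublinear (\<lambda>x. INF q\<in>C. q x)"
  unfolding sublinear_def
proof (intro conjI allI impI)
  fix x y
  have "(INF q\<in>C. q (x + y)) - q x \<le> r y" if q: "q \<in> C" and r: "r \<in> C" for q r
  proof -
    obtain s where s: "s \<in> C" "s \<le> q" "s \<le> r"
      using chain[OF q r] q r by blast
    have "(INF q\<in>C. q (x + y)) \<le> s (x + y)"
      by (rule cINF_lower[OF bdd s(1)])
    also have "\<dots> \<le> s x + s y"
      using C(2)[OF s(1)] by (rule sublinear_add)
    also have "\<dots> \<le> q x + r y"
      using s by (intro add_mono) (auto simp: le_fun_def)
    finally show ?thesis by simp
  qed
  then have "(INF q\<in>C. q (x + y)) - q x \<le> (INF r\<in>C. r y)" if "q \<in> C" for q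
    using that C(1) by (intro cINF_greatest) auto
  then have "(INF q\<in>C. q (x + y)) - (INF r\<in>C. r y) \<le> (INF q\<in>C. q x)"
    using C(1) by (intro cINF_greatest) (auto simp: algebra_simps)
  then show "(INF q\<in>C. q (x + y)) \<le> (INF q\<in>C. q x) + (INF q\<in>C. q y)"
    by simp
next
  fix c :: real and x :: 'a
  assume c: "c > 0"
  have img: "(\<lambda>q. q (c *\<^sub>R x)) ` C = (\<lambda>q. c * q x) ` C"
    using C(2) c by (intro image_cong) (auto simp: sublinear_scaleR)
  have le: "c * (INF q\<in>C. q x) \<le> (INF q\<in>C. c * q x)"
    using C(1) c bdd[of x] by (intro cINF_greatest mult_left_mono cINF_lower) auto
  have bdd': "bdd_below ((\<lambda>q. c * q x) ` C)"
    using bdd[of "c *\<^sub>R x"] unfolding img .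
  have "(INF q\<in>C. c * q x) / c \<le> (INF q\<in>C. q x)"
  proof (rule cINF_greatest[OF C(1)])
    fix q assume "q \<in> C"
    then have "(INF q\<in>C. c * q x) \<le> c * q x"
      by (rule cINF_lower[OF bdd'])
    then show "(INF q\<in>C. c * q x) / c \<le> q x"
      using c by (simp add: field_simps)
  qed
  then show "(INF q\<in>C. q (c *\<^sub>R x)) = c * (INF q\<in>C. q x)"
    using le c unfolding img by (simp add: field_simps)
qed

text \<open>The lower bound that Zorn's lemma needs for a chain exists because every sublinear
  \<open>q \<le> p\<close> satisfies \<open>q x \<ge> - q (- x) \<ge> - p (- x)\<close>.\<close>

lemma exists_minimal_sublinear:
  assumes p: "sublinear p"
  obtains q where "sublinear q" "q \<le> p" "\<And>r. sublinear r \<Longrightarrow> r \<le> q \<Longrightarrow> r = q"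
proof -
  let ?A = "{q. sublinear q \<and> q \<le> p}"
  let ?P = "\<lambda>q r. r \<le> (q :: 'a \<Rightarrow> real)"
  have "\<exists>m\<in>?A. \<forall>a\<in>?A. ?P m a \<longrightarrow> a = m"
  proof (rule predicate_Zorn)
    show "partial_order_on ?A (relation_of ?P ?A)"
      by (rule partial_order_on_relation_ofI) auto
  next
    fix C assume C: "C \<in> Chains (relation_of ?P ?A)"
    then have CA: "C \<subseteq> ?A" by (rule Chains_relation_of)
    have chain: "q \<le> r \<or> r \<le> q" if "q \<in> C" "r \<in> C" for q r
      using C that unfolding Chains_def relation_of_def by auto
    have bdd: "bdd_below ((\<lambda>q. q x) ` C)" for x
    proof (rule bdd_belowI2)
      fix q assume "q \<in> C"
      with CA have q: "sublinear q" "q \<le> p" by auto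
      have "- p (- x) \<le> - q (- x)" using q(2) by (simp add: le_fun_def)
      also have "\<dots> \<le> q x" using q(1) by (rule sublinear_uminus)
      finally show "- p (- x) \<le> q x" .
    qed
    show "\<exists>u\<in>?A. \<forall>a\<in>C. u \<le> a"
    proof (cases "C = {}")
      case True
      then show ?thesis using p by auto
    next
      case False
      let ?u = "\<lambda>x. INF q\<in>C. q x"
      have le: "?u \<le> a" if "a \<in> C" for a
        using that by (auto simp: le_fun_def intro!: cINF_lower bdd)
      moreover from False obtain a where "a \<in> C" by auto
      then have "?u \<le> p" using le CA by (blast intro: order_trans)
      moreover have "sublinear ?u"
        using False CA chain bdd by (intro sublinear_Inf_chain) auto
      ultimately show ?thesis by blast
    qed
  qed
  then show ?thesis using that by (auto intro: order_trans)
qed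

text \<open>For fixed \<open>y\<close>, pushing \<open>q\<close> down along the direction \<open>y\<close> gives the sublinear functional
  \<open>r x = inf\<^bsub>t \<ge> 0\<^esub> (q (x + t y) - t q y) \<le> q x\<close>. Minimality forces \<open>r = q\<close>, and \<open>t = 1\<close> then
  yields the superadditivity \<open>q x + q y \<le> q (x + y)\<close>.\<close>

lemma sublinear_minimal_linear:
  assumes q: "sublinear q" and min: "\<And>r. sublinear r \<Longrightarrow> r \<le> q \<Longrightarrow> r = q"
  shows "linear q"
proof -
  have additive: "q x + q y = q (x + y)" for x y
  proof -
    define T where "T = {0::real..}"
    define r where "r x = (INF t\<in>T. q (x + t *\<^sub>R y) - t * q y)" for x
    have T: "T \<noteq> {}" by (auto simp: T_def)
    have qt: "q (t *\<^sub>R y) = t * q y" if "t \<in> T" for t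
      using that sublinear_scaleR[OF q, of t y] sublinear_zero[OF q]
      by (cases "t = 0") (auto simp: T_def)
    have bdd: "bdd_below ((\<lambda>t. q (x + t *\<^sub>R y) - t * q y) ` T)" for x
    proof (rule bdd_belowI2)
      fix t assume "t \<in> T"
      then show "- q (- x) \<le> q (x + t *\<^sub>R y) - t * q y"
        using sublinear_add[OF q, of "x + t *\<^sub>R y" "- x"] qt[of t] by simp
    qed
    have r_le: "r x \<le> q (x + t *\<^sub>R y) - t * q y" if "t \<in> T" for x t
      unfolding r_def by (rule cINF_lower[OF bdd that])
    have r_ge: "a \<le> r x" if "\<And>t. t \<in> T \<Longrightarrow> a \<le> q (x + t *\<^sub>R y) - t * q y" for x a
      unfolding r_def by (rule cINF_greatest[OF T that])
    have "sublinear r"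
      unfolding sublinear_def
    proof (intro conjI allI impI)
      fix a b
      have "r (a + b) - (q (a + s *\<^sub>R y) - s * q y) \<le> q (b + t *\<^sub>R y) - t * q y"
        if "s \<in> T" "t \<in> T" for s t
      proof -
        have "s + t \<in> T" using that by (auto simp: T_def)
        from r_le[OF this, of "a + b"]
        have "r (a + b) \<le> q ((a + s *\<^sub>R y) + (b + t *\<^sub>R y)) - (s + t) * q y"
          by (simp add: algebra_simps)
        also have "\<dots> \<le> q (a + s *\<^sub>R y) + q (b + t *\<^sub>R y) - (s + t) * q y"
          using sublinear_add[OF q] by simp
        finally show ?thesis by (simp add: algebra_simps)
      qed
      then have "r (a + b) - (q (a + s *\<^sub>R y) - s * q y) \<le> r b" if "s \<in> T" for s
        using that by (intro r_ge)
      then have "r (a + b) - r b \<le> r a"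
        by (intro r_ge) (simp add: algebra_simps)
      then show "r (a + b) \<le> r a + r b" by simp
    next
      have le: "r (c *\<^sub>R a) \<le> c * r a" if c: "c > 0" for c a
      proof -
        have "r (c *\<^sub>R a) / c \<le> r a"
        proof (rule r_ge)
          fix t assume t: "t \<in> T"
          then have "c * t \<in> T" using c by (auto simp: T_def)
          from r_le[OF this, of "c *\<^sub>R a"]
          have "r (c *\<^sub>R a) \<le> q (c *\<^sub>R (a + t *\<^sub>R y)) - c * t * q y"
            by (simp add: algebra_simps)
          also have "\<dots> = c * (q (a + t *\<^sub>R y) - t * q y)"
            by (simp only: sublinear_scaleR[OF q c]) (simp add: algebra_simps)
          finally show "r (c *\<^sub>R a) / c \<le> q (a + t *\<^sub>R y) - t * q y"
            using c by (simp add: field_simps)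
        qed
        then show ?thesis using c by (simp add: field_simps)
      qed
      fix c :: real and a
      assume c: "c > 0"
      have "r a \<le> inverse c * r (c *\<^sub>R a)"
        using le[of "inverse c" "c *\<^sub>R a"] c by simp
      then show "r (c *\<^sub>R a) = c * r a"
        using le[OF c, of a] c by (simp add: field_simps)
    qed
    moreover have "r \<le> q"
      using r_le[of 0] by (auto simp: le_fun_def T_def)
    ultimately have "r = q" by (rule min)
    then have "q x \<le> q (x + y) - q y"
      using r_le[of 1 x] by (auto simp: T_def)
    then show ?thesis
      using sublinear_add[OF q, of x y] by simp
  qed
  have neg: "q (- x) = - q x" for x
    using additive[of x "- x"] sublinear_zero[OF q] by simp
  have "q (c *\<^sub>R x) = c * q x" for c x
  proof -
    consider "c > 0" | "c = 0" | "- c > 0" by linarith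
    then show ?thesis
    proof cases
      case 3
      then have "q ((- c) *\<^sub>R x) = - c * q x" by (rule sublinear_scaleR[OF q])
      then show ?thesis using neg[of "c *\<^sub>R x"] by simp
    qed (auto simp: sublinear_zero[OF q] sublinear_scaleR[OF q])
  qed
  then show ?thesis
    using additive by (intro linearI) auto
qed

lemma hahn_banach_sublinear:
  assumes "sublinear p"
  obtains l where "linear l" "\<And>x. l x \<le> p x"
  using exists_minimal_sublinear[OF assms] sublinear_minimal_linear by (metis le_fun_def)

text \<open>Think of \<open>E\<close> as the epigraph of a convex function with value at least \<open>m\<close> at \<open>0\<close> and bounded
  above by \<open>M\<close> near \<open>0\<close>. Its directional derivative at \<open>0\<close>, the infimum \<open>p\<close> of the difference
  quotients \<open>(r - m) / t\<close>, is sublinear: a quotient in direction \<open>y\<close> and one in direction \<open>- y\<close>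
  combine to a point of \<open>E\<close> above \<open>0\<close>, which bounds \<open>p\<close> from below. A linear functional below \<open>p\<close>
  is the slope sought, and the bound \<open>M\<close> makes it continuous.\<close>

lemma convex_set_affine_minorant:
  fixes E :: "('y::real_normed_vector \<times> real) set"
  assumes E: "convex E"
    and above: "\<And>r. (0, r) \<in> E \<Longrightarrow> m \<le> r"
    and e: "e > 0" and ball: "\<And>y. norm y < e \<Longrightarrow> (y, M) \<in> E"
  obtains l :: "'y \<Rightarrow>\<^sub>L real" where "\<And>y r. (y, r) \<in> E \<Longrightarrow> m + blinfun_apply l y \<le> r"
proof -
  define Q where "Q y = {(t, r). t > 0 \<and> (t *\<^sub>R y, r) \<in> E}" for y :: 'y
  define k where "k = (\<lambda>(t::real, r). (r - m) / t)"
  define p where "p y = (INF z\<in>Q y. k z)" for y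
  (* A step length that keeps every direction y inside the ball on which M is available;
     adding 1 to the norm covers y = 0. *)
  define step where "step y = e / (2 * (norm y + 1))" for y :: 'y
  have step: "step y > 0" "norm (step y *\<^sub>R y) < e" for y
  proof -
    have pos: "norm y + 1 > 0" using norm_ge_zero[of y] by linarith
    show "step y > 0" unfolding step_def using e pos by simp
    have "norm (step y *\<^sub>R y) = e * (norm y / (2 * (norm y + 1)))"
      using e by (simp add: step_def)
    also have "\<dots> < e * 1"
      using e pos by (intro mult_strict_left_mono) (auto simp: field_simps)
    finally show "norm (step y *\<^sub>R y) < e" by simp
  qed
  have stepQ: "(step y, M) \<in> Q y" for y
    using step ball by (auto simp: Q_def)
  then have ne: "Q y \<noteq> {}" for y by blast
  have opposite: "- (s - m) / v \<le> (r - m) / t" if "(t, r) \<in> Q y" "(v, s) \<in> Q (- y)" for y t r v s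
  proof -
    have tv: "t > 0" "v > 0" and mem: "(t *\<^sub>R y, r) \<in> E" "(v *\<^sub>R (- y), s) \<in> E"
      using that by (auto simp: Q_def)
    (* These weights make the first components cancel. *)
    have "(v / (t + v)) *\<^sub>R (t *\<^sub>R y, r) + (t / (t + v)) *\<^sub>R (v *\<^sub>R (- y), s) \<in> E"
      using tv by (intro convexD[OF E mem]) (simp_all add: add_divide_distrib[symmetric] add.commute)
    then have "(0, (v * r + t * s) / (t + v)) \<in> E"
      by (simp add: add_divide_distrib mult.commute)
    from above[OF this] show ?thesis
      using tv by (simp add: field_simps)
  qed
  have bdd: "bdd_below (k ` Q y)" for y
    using opposite[OF _ stepQ[of "- y"]] unfolding k_def
    by (intro bdd_belowI2[where m = "- (M - m) / step (- y)"]) auto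
  have p_le: "p y \<le> (r - m) / t" if "(t, r) \<in> Q y" for y t r
    using cINF_lower[OF bdd that] by (simp add: p_def k_def)
  have p_ge: "a \<le> p y" if "\<And>t r. (t, r) \<in> Q y \<Longrightarrow> a \<le> (r - m) / t" for y a
    unfolding p_def using that by (intro cINF_greatest[OF ne]) (auto simp: k_def)
  have "sublinear p"
    unfolding sublinear_def
  proof (intro conjI allI impI)
    fix y z
    have "p (y + z) - (r - m) / t \<le> (s - m) / v" if "(t, r) \<in> Q y" "(v, s) \<in> Q z" for t r v s
    proof -
      have tv: "t > 0" "v > 0" and mem: "(t *\<^sub>R y, r) \<in> E" "(v *\<^sub>R z, s) \<in> E"
        using that by (auto simp: Q_def)
      have "(v / (t + v)) *\<^sub>R (t *\<^sub>R y, r) + (t / (t + v)) *\<^sub>R (v *\<^sub>R z, s) \<in> E"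
        using tv by (intro convexD[OF E mem]) (simp_all add: add_divide_distrib[symmetric] add.commute)
      then have "(t * v / (t + v), (v * r + t * s) / (t + v)) \<in> Q (y + z)"
        using tv by (simp add: Q_def algebra_simps add_divide_distrib)
      from p_le[OF this] have "p (y + z) \<le> ((v * r + t * s) / (t + v) - m) / (t * v / (t + v))" .
      also have "\<dots> = (r - m) / t + (s - m) / v"
      proof -
        have "(v * r + t * s) / (t + v) - m = (v * (r - m) + t * (s - m)) / (t + v)"
          using tv by (simp add: field_simps)
        then show ?thesis using tv by (simp add: divide_simps)
      qed
      finally show ?thesis by simp
    qed
    then have "p (y + z) - (r - m) / t \<le> p z" if "(t, r) \<in> Q y" for t r
      using that by (intro p_ge)
    then have "p (y + z) - p z \<le> p y"
      by (intro p_ge) (simp add: algebra_simps)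
    then show "p (y + z) \<le> p y + p z" by simp
  next
    have le: "p (c *\<^sub>R y) \<le> c * p y" if c: "c > 0" for c y
    proof -
      have "p (c *\<^sub>R y) / c \<le> p y"
      proof (rule p_ge)
        fix t r assume "(t, r) \<in> Q y"
        then have "(t / c, r) \<in> Q (c *\<^sub>R y)"
          using c by (auto simp: Q_def)
        from p_le[OF this] show "p (c *\<^sub>R y) / c \<le> (r - m) / t"
          using c by (simp add: field_simps)
      qed
      then show ?thesis using c by (simp add: field_simps)
    qed
    fix c :: real and y
    assume c: "c > 0"
    have "p y \<le> inverse c * p (c *\<^sub>R y)"
      using le[of "inverse c" "c *\<^sub>R y"] c by simp
    then show "p (c *\<^sub>R y) = c * p y"
      using le[OF c, of y] c by (simp add: field_simps)
  qed
  then obtain l where l: "linear l" "\<And>x. l x \<le> p x"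
    using hahn_banach_sublinear by blast
  have m0: "m \<le> M" using above ball[of 0] e by simp
  have l_le: "l y \<le> (M - m) / (e / 2) * norm y" for y
  proof (cases "y = 0")
    case True
    then show ?thesis using linear_0[OF l(1)] by simp
  next
    case False
    then have "(e / (2 * norm y), M) \<in> Q y"
      using e ball[of "(e / (2 * norm y)) *\<^sub>R y"] by (simp add: Q_def)
    from order_trans[OF l(2) p_le[OF this]] show ?thesis
      by (simp add: field_simps)
  qed
  have "bounded_linear l"
  proof (rule bounded_linear_intro)
    show "l (x + y) = l x + l y" "l (c *\<^sub>R x) = c *\<^sub>R l x" for x y c
      using l(1) by (auto simp: linear_add linear_scale)
    show "norm (l y) \<le> norm y * ((M - m) / (e / 2))" for y
      using l_le[of y] l_le[of "- y"] linear_neg[OF l(1), of y] by (simp add: abs_le_iff mult.commute)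
  qed
  then have app: "blinfun_apply (Blinfun l) = l" by (rule bounded_linear_Blinfun_apply)
  show thesis
  proof (rule that)
    fix y r assume "(y, r) \<in> E"
    then have "(1, r) \<in> Q y" by (simp add: Q_def)
    from order_trans[OF l(2) p_le[OF this]] show "m + blinfun_apply (Blinfun l) y \<le> r"
      by (simp add: app)
  qed
qed

section \<open>Conjugates of smooth convex functions on the line\<close>

lemma convex_fun_imp_convex_on:
  assumes "convex_fun g" "proper_fun g"
  shows "convex_on {x. \<bar>g x\<bar> \<noteq> \<infinity>} (\<lambda>x. real_of_ereal (g x))"
proof -
  have *: "\<bar>g (s *\<^sub>R x + (1 - s) *\<^sub>R y)\<bar> \<noteq> \<infinity> \<and>
      real_of_ereal (g (s *\<^sub>R x + (1 - s) *\<^sub>R y))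
        \<le> s * real_of_ereal (g x) + (1 - s) * real_of_ereal (g y)"
    if "\<bar>g x\<bar> \<noteq> \<infinity>" "\<bar>g y\<bar> \<noteq> \<infinity>" "0 \<le> s" "s \<le> 1" for x y s
  proof -
    have "g (s *\<^sub>R x + (1 - s) *\<^sub>R y) \<le> ereal s * g x + ereal (1 - s) * g y"
      using assms(1) that by (auto simp: convex_fun_def)
    moreover have "g (s *\<^sub>R x + (1 - s) *\<^sub>R y) \<noteq> -\<infinity>"
      using assms(2) by (auto simp: proper_fun_def)
    ultimately show ?thesis
      using that by (cases "g x"; cases "g y"; cases "g (s *\<^sub>R x + (1 - s) *\<^sub>R y)") auto
  qed
  show ?thesis
  proof (rule convex_onI)
    show "convex {x. \<bar>g x\<bar> \<noteq> \<infinity>}"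
      unfolding convex_alt
    proof (intro ballI allI impI CollectI)
      fix x y and u :: real
      assume xy: "x \<in> {x. \<bar>g x\<bar> \<noteq> \<infinity>}" "y \<in> {x. \<bar>g x\<bar> \<noteq> \<infinity>}" and u: "0 \<le> u \<and> u \<le> 1"
      show "\<bar>g ((1 - u) *\<^sub>R x + u *\<^sub>R y)\<bar> \<noteq> \<infinity>"
        using *[OF CollectD[OF xy(2)] CollectD[OF xy(1)], of u] u by (simp add: add.commute)
    qed
  next
    fix t x y assume "0 < t" "t < (1::real)" "x \<in> {x. \<bar>g x\<bar> \<noteq> \<infinity>}" "y \<in> {x. \<bar>g x\<bar> \<noteq> \<infinity>}"
    then show "real_of_ereal (g ((1 - t) *\<^sub>R x + t *\<^sub>R y))
        \<le> (1 - t) * real_of_ereal (g x) + t * real_of_ereal (g y)"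
      using *[of x y "1 - t"] by simp
  qed
qed

text \<open>The setting is that of the integrand \<open>\<phi> t\<close> for one fixed \<open>t\<close>. The open set \<open>U\<close> may be
  disconnected; global convexity of \<open>g\<close> is what makes \<open>g'\<close> injective across its components.\<close>

locale smooth_convex_integrand =
  fixes g :: "real \<Rightarrow> ereal" and U :: "real set"
  assumes proper: "proper_fun g" and convex: "convex_fun g"
    and openU: "open U" and smooth: "times_differentiable_on 3 g U"
    and curved: "\<And>z. z \<in> U \<Longrightarrow> ederiv 2 g z \<noteq> 0"
begin

lemma finite_value: "z \<in> U \<Longrightarrow> \<bar>g z\<bar> \<noteq> \<infinity>"
  using smooth by (auto simp: times_differentiable_on_def)

lemma has_ederiv: "z \<in> U \<Longrightarrow> k < 3 \<Longrightarrow> (ederiv k g has_real_derivative ederiv (Suc k) g z) (at z)"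
  using smooth unfolding times_differentiable_on_def ederiv_def
  by (auto simp: field_differentiable_derivI)

lemma has_ederiv_0:
  "z \<in> U \<Longrightarrow> ((\<lambda>x. real_of_ereal (g x)) has_real_derivative ederiv 1 g z) (at z)"
  using has_ederiv[of z 0] by (simp add: ederiv_def)

lemma tangent_below:
  assumes z: "z \<in> U" shows "g z + ereal (ederiv 1 g z * (x - z)) \<le> g x"
proof (cases "g x")
  case (real r)
  let ?D = "{x. \<bar>g x\<bar> \<noteq> \<infinity>}"
  have cv: "convex_on ?D (\<lambda>x. real_of_ereal (g x))"
    by (rule convex_fun_imp_convex_on[OF convex proper])
  have "connected ?D"
    using cv by (intro convex_connected) (auto simp: convex_on_def)
  moreover have "z \<in> interior ?D"
    by (rule interiorI[OF openU z]) (rule subsetI, rule CollectI, rule finite_value)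
  ultimately have "ederiv 1 g z * (x - z) \<le> real_of_ereal (g x) - real_of_ereal (g z)"
    using convex_on_imp_above_tangent[OF cv, of z x]
      has_field_derivative_at_within[OF has_ederiv_0[OF z], of ?D] real by simp
  then show ?thesis
    using finite_value[OF z] real by (cases "g z") auto
next
  case MInf
  then show ?thesis using proper by (auto simp: proper_fun_def)
qed auto

lemma ederiv_mono:
  assumes "z \<in> U" "w \<in> U" "z < w" shows "ederiv 1 g z \<le> ederiv 1 g w"
proof -
  have "ederiv 1 g z * (w - z) \<le> ederiv 1 g w * (w - z)"
    using tangent_below[OF assms(1), of w] tangent_below[OF assms(2), of z]
      finite_value[OF assms(1)] finite_value[OF assms(2)]
    by (cases "g z"; cases "g w") (auto simp: algebra_simps)
  then show ?thesis using assms(3) by simp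
qed

text \<open>Equal slopes at \<open>z < w\<close> would, by monotonicity, make the slope constant to the right of \<open>z\<close>,
  although \<open>g''\<close> does not vanish at \<open>z\<close>.\<close>

lemma ederiv_strict_mono:
  assumes z: "z \<in> U" and w: "w \<in> U" "z < w" shows "ederiv 1 g z < ederiv 1 g w"
proof (rule ccontr)
  assume "\<not> ?thesis"
  with ederiv_mono[OF assms] have eq: "ederiv 1 g w = ederiv 1 g z" by simp
  obtain e where e: "e > 0" "ball z e \<subseteq> U"
    using openU z openE by blast
  have const: "ederiv 1 g (z + h) = ederiv 1 g z" if "0 < h" "h < min e (w - z)" for h
  proof -
    have "z + h \<in> U" using that e by (auto simp: dist_real_def)
    then show ?thesis
      using ederiv_mono[OF z, of "z + h"] ederiv_mono[OF _ w(1), of "z + h"] that eq by simp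
  qed
  have D: "(ederiv 1 g has_real_derivative ederiv 2 g z) (at z)"
    using has_ederiv[OF z, of 1] by (simp add: numeral_2_eq_2)
  have "\<exists>d>0. \<forall>h>0. h < d \<longrightarrow> ederiv 1 g (z + h) \<noteq> ederiv 1 g z"
  proof (cases "ederiv 2 g z > 0")
    case True
    from DERIV_pos_inc_right[OF D this] show ?thesis by (metis less_irrefl)
  next
    case False
    then have "ederiv 2 g z < 0" using curved[OF z] by simp
    from DERIV_neg_dec_right[OF D this] show ?thesis by (metis less_irrefl)
  qed
  then obtain d where d: "d > 0" "\<And>h. 0 < h \<Longrightarrow> h < d \<Longrightarrow> ederiv 1 g (z + h) \<noteq> ederiv 1 g z"
    by blast
  define h where "h = min d (min e (w - z)) / 2"
  have "0 < h" "h < d" "h < min e (w - z)"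
    using d(1) e(1) w(2) by (auto simp: h_def min_def)
  then show False using const d(2) by blast
qed

lemma inj_on_ederiv: "inj_on (ederiv 1 g) U"
proof (rule linorder_inj_onI')
  fix z w assume "z \<in> U" "w \<in> U" "z < w"
  from ederiv_strict_mono[OF this] show "ederiv 1 g z \<noteq> ederiv 1 g w" by simp
qed

abbreviation slopes :: "real set" where "slopes \<equiv> ederiv 1 g ` U"

definition inv_slope :: "real \<Rightarrow> real" where "inv_slope = inv_into U (ederiv 1 g)"

lemma inv_slope: "q \<in> slopes \<Longrightarrow> inv_slope q \<in> U" "q \<in> slopes \<Longrightarrow> ederiv 1 g (inv_slope q) = q"
  and inv_slope_ederiv: "z \<in> U \<Longrightarrow> inv_slope (ederiv 1 g z) = z"
  by (simp_all only: inv_slope_def inv_into_into f_inv_into_f inv_into_f_f[OF inj_on_ederiv])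

lemma continuous_ederiv: "continuous_on U (ederiv 1 g)"
  using has_ederiv[of _ 1] by (intro DERIV_continuous_on) (auto intro: has_field_derivative_at_within)

lemma open_slopes: "open slopes"
  by (rule invariance_of_domain[OF continuous_ederiv openU inj_on_ederiv])

lemma has_deriv_inv_slope:
  assumes "q \<in> slopes"
  shows "(inv_slope has_real_derivative inverse (ederiv 2 g (inv_slope q))) (at q)"
proof -
  let ?z = "inv_slope q"
  have D: "(ederiv 1 g has_real_derivative ederiv 2 g z) (at z)" if "z \<in> U" for z
    using has_ederiv[OF that, of 1] by (simp add: numeral_2_eq_2)
  have dz: "(ederiv 1 g has_derivative (*) (ederiv 2 g ?z)) (at ?z)"
    using D[OF inv_slope(1)[OF assms]] by (simp only: has_field_derivative_def)
  have id: "(*) (ederiv 2 g ?z) \<circ> (*) (inverse (ederiv 2 g ?z)) = id"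
    using curved[OF inv_slope(1)[OF assms]] by (auto simp: fun_eq_iff)
  have "(inv_slope has_derivative (*) (inverse (ederiv 2 g ?z))) (at (ederiv 1 g ?z))"
    by (rule has_derivative_inverse_strong[where f = "ederiv 1 g" and g = inv_slope,
          OF openU inv_slope(1)[OF assms] continuous_ederiv inv_slope_ederiv dz id])
  then show ?thesis
    by (simp only: inv_slope(2)[OF assms] has_field_derivative_def)
qed

text \<open>For a slope \<open>q\<close> taken in \<open>U\<close>, the tangent at the point with slope \<open>q\<close> lies below \<open>g\<close>, so the
  supremum defining the conjugate is attained there.\<close>

lemma conjugate_on_slopes:
  assumes q: "q \<in> slopes"
  shows "fenchel_conjugate (*) g q = ereal (q * inv_slope q - real_of_ereal (g (inv_slope q)))"
proof -
  let ?z = "inv_slope q"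
  obtain r where r: "g ?z = ereal r"
    using finite_value[OF inv_slope(1)[OF q]] by (cases "g ?z") auto
  have le: "ereal (q * x) - g x \<le> ereal (q * ?z - r)" for x
    using tangent_below[OF inv_slope(1)[OF q], of x, unfolded inv_slope(2)[OF q]] proper r
    by (cases "g x") (auto simp: algebra_simps proper_fun_def)
  have "(SUP x. ereal (q * x) - g x) = ereal (q * ?z - r)"
  proof (rule SUP_eqI)
    fix y assume "\<And>x. x \<in> UNIV \<Longrightarrow> ereal (q * x) - g x \<le> y"
    then have "ereal (q * ?z) - g ?z \<le> y" by blast
    then show "ereal (q * ?z - r) \<le> y" by (simp add: r)
  qed (rule le)
  then show ?thesis
    by (simp add: fenchel_conjugate_def r)
qed

text \<open>Differentiating \<open>q z - g z\<close> along \<open>z = inv_slope q\<close>, the two terms containing the derivative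
  of \<open>inv_slope\<close> cancel because \<open>g' z = q\<close>.\<close>

lemma deriv_conjugate:
  assumes q: "q \<in> slopes"
  shows "ederiv 1 (fenchel_conjugate (*) g) q = inv_slope q"
proof -
  let ?z = "inv_slope q"
  note D = has_deriv_inv_slope[OF q]
  have D': "((\<lambda>x. real_of_ereal (g x)) has_real_derivative q) (at ?z)"
    using has_ederiv_0[OF inv_slope(1)[OF q]] inv_slope(2)[OF q] by simp
  have "((\<lambda>q. q * inv_slope q - real_of_ereal (g (inv_slope q))) has_real_derivative ?z) (at q)"
    using D DERIV_chain2[OF D' D] by (auto intro!: derivative_eq_intros)
  then have "((\<lambda>q. real_of_ereal (fenchel_conjugate (*) g q)) has_real_derivative ?z) (at q)"
    by (rule has_field_derivative_transform_within_open[OF _ open_slopes q])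
       (simp add: conjugate_on_slopes)
  then show ?thesis
    by (simp add: ederiv_def DERIV_imp_deriv)
qed

text \<open>The quotient \<open>g''' / (g'')\<^sup>3\<close> is, up to sign, the second derivative of the inverse function of
  \<open>g'\<close>, so that a bound on it is a bound on the Lagrange remainder of order two.\<close>

lemma inv_slope_taylor:
  assumes seg: "closed_segment 0 q \<subseteq> slopes"
    and bound: "\<And>z. z \<in> U \<Longrightarrow> \<bar>ederiv 3 g z / (ederiv 2 g z) ^ 3\<bar> \<le> C"
  shows "\<bar>inv_slope q - inv_slope 0 - q / ederiv 2 g (inv_slope 0)\<bar> \<le> C / 2 * q\<^sup>2"
proof (cases "q = 0")
  case False
  define s where "s y = inverse (ederiv 2 g (inv_slope y))" for y
  define k where "k y = - (ederiv 3 g (inv_slope y) / (ederiv 2 g (inv_slope y)) ^ 3)" for y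
  have Ds: "(s has_real_derivative k y) (at y)" if y: "y \<in> slopes" for y
  proof -
    have "(ederiv 2 g has_real_derivative ederiv 3 g (inv_slope y)) (at (inv_slope y))"
      using has_ederiv[OF inv_slope(1)[OF y], of 2] by (simp add: numeral_3_eq_3 numeral_2_eq_2)
    from DERIV_chain2[OF this has_deriv_inv_slope[OF y]] show ?thesis
      unfolding s_def k_def using curved[OF inv_slope(1)[OF y]]
      by (auto intro!: derivative_eq_intros simp: field_simps power3_eq_cube)
  qed
  define d where "d = (\<lambda>n::nat. if n = 0 then inv_slope else if n = 1 then s else k)"
  have "\<exists>t. (if q < 0 then q < t \<and> t < 0 else 0 < t \<and> t < q) \<and>
    inv_slope q = (\<Sum>m<2. (d m 0 / fact m) * (q - 0)^m) + (d 2 t / fact 2) * (q - 0)^2"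
  proof (rule Taylor[where a = "min 0 q" and b = "max 0 q"])
    show "\<forall>m t. m < 2 \<and> min 0 q \<le> t \<and> t \<le> max 0 q \<longrightarrow> (d m has_real_derivative d (Suc m) t) (at t)"
    proof (intro allI impI)
      fix m :: nat and t assume t: "m < 2 \<and> min 0 q \<le> t \<and> t \<le> max 0 q"
      then have "t \<in> slopes"
        using seg by (auto simp: closed_segment_eq_real_ivl min_def max_def split: if_splits)
      then show "(d m has_real_derivative d (Suc m) t) (at t)"
        using t Ds has_deriv_inv_slope by (auto simp: d_def less_2_cases_iff s_def[abs_def])
    qed
  qed (use False in \<open>auto simp: d_def\<close>)
  then obtain t where t: "if q < 0 then q < t \<and> t < 0 else 0 < t \<and> t < q"
    "inv_slope q = inv_slope 0 + q * s 0 + k t / 2 * q\<^sup>2"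
    by (auto simp: d_def numeral_2_eq_2)
  have "t \<in> slopes"
    using seg t(1) by (auto simp: closed_segment_eq_real_ivl split: if_splits)
  then have "\<bar>k t\<bar> \<le> C" using bound[OF inv_slope(1)] by (simp add: k_def)
  then have "\<bar>k t\<bar> * (q\<^sup>2 / 2) \<le> C * (q\<^sup>2 / 2)" by (rule mult_right_mono) simp
  moreover have "inv_slope q - inv_slope 0 - q / ederiv 2 g (inv_slope 0) = k t / 2 * q\<^sup>2"
    unfolding t(2) s_def divide_inverse by simp
  ultimately show ?thesis
    by (simp only: abs_mult abs_divide abs_power2)
next
  case True
  then show ?thesis by simp
qed

text \<open>Slopes along the whole ray are required, since Taylor's formula needs the segment between
  \<open>0\<close> and \<open>- \<alpha> m\<close> to consist of slopes taken in \<open>U\<close>, and the image of \<open>U\<close> need not be convex.\<close>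

lemma conjugate_deriv_taylor:
  assumes z: "z \<in> U" "ederiv 1 g z = 0"
    and bound: "\<And>w. w \<in> U \<Longrightarrow> \<bar>ederiv 3 g w / (ederiv 2 g w) ^ 3\<bar> \<le> C"
    and ray: "\<And>\<beta>. 0 < \<beta> \<Longrightarrow> \<beta> < \<alpha>0 \<Longrightarrow> - \<beta> * m \<in> slopes"
    and \<alpha>: "0 < \<alpha>" "\<alpha> < \<alpha>0"
  shows "\<bar>ederiv 1 (fenchel_conjugate (*) g) (- \<alpha> * m) - z + \<alpha> * (m / ederiv 2 g z)\<bar>
           \<le> C / 2 * (\<alpha> * m)\<^sup>2"
proof -
  have z0: "inv_slope 0 = z" using inv_slope_ederiv[OF z(1)] z(2) by simp
  have "closed_segment 0 (- \<alpha> * m) \<subseteq> slopes"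
  proof
    fix y assume "y \<in> closed_segment 0 (- \<alpha> * m)"
    then obtain s where s: "0 \<le> s" "s \<le> 1" "y = - (s * \<alpha>) * m"
      by (auto simp: in_segment algebra_simps)
    show "y \<in> slopes"
    proof (cases "s = 0")
      case True
      then show ?thesis using z s(3) by (auto intro!: image_eqI[of _ _ z])
    next
      case False
      then have "0 < s * \<alpha>" using s(1) \<alpha>(1) by simp
      moreover have "s * \<alpha> < \<alpha>0"
        using mult_right_mono[OF s(2), of \<alpha>] \<alpha> by linarith
      ultimately show ?thesis using ray[of "s * \<alpha>"] s(3) by (simp only: mult_minus_left)
    qed
  qed
  from inv_slope_taylor[OF this bound] deriv_conjugate[OF ray[OF \<alpha>]] show ?thesis
    by (simp add: z0)
qed

end

section \<open>Absence of a duality gap\<close>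

lemma convex_fun_ereal_le:
  assumes "convex_fun g" "g x \<le> ereal a" "g y \<le> ereal b" "0 \<le> s" "0 \<le> t" "s + t = 1"
  shows "g (s *\<^sub>R x + t *\<^sub>R y) \<le> ereal (s * a + t * b)"
proof -
  have t: "t = 1 - s" using assms by simp
  have "g (s *\<^sub>R x + t *\<^sub>R y) \<le> ereal s * g x + ereal t * g y"
    using assms unfolding t convex_fun_def by auto
  also have "\<dots> \<le> ereal s * ereal a + ereal t * ereal b"
    using assms by (intro add_mono ereal_mult_left_mono) auto
  finally show ?thesis by simp
qed

text \<open>This set consists of the pairs \<open>(y, r)\<close> for which \<open>r\<close> bounds, at some \<open>x\<close>, the objective
  \<open>c H (A x + y) + R x\<close> of the problem perturbed by \<open>y\<close>. Using finite upper bounds \<open>a\<close> and \<open>b\<close>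
  instead of the values of \<open>H\<close> and \<open>R\<close> keeps it inside \<open>Y \<times> \<real>\<close>.\<close>

lemma convex_value_set:
  fixes A :: "'x::real_normed_vector \<Rightarrow>\<^sub>L 'y::real_normed_vector"
  assumes H: "convex_fun H" and R: "convex_fun R" and c: "c \<ge> 0"
  shows "convex {(z - blinfun_apply A x, c * a + b) | z x a b. H z \<le> ereal a \<and> R x \<le> ereal b}"
    (is "convex ?E")
proof (rule convexI)
  fix P Q and s t :: real
  assume P: "P \<in> ?E" and Q: "Q \<in> ?E" and st: "0 \<le> s" "0 \<le> t" "s + t = 1"
  obtain z x a b where 1: "P = (z - blinfun_apply A x, c * a + b)" "H z \<le> ereal a" "R x \<le> ereal b"
    using P by blast
  obtain z' x' a' b' where 2: "Q = (z' - blinfun_apply A x', c * a' + b')" "H z' \<le> ereal a'" "R x' \<le> ereal b'"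
    using Q by blast
  have "H (s *\<^sub>R z + t *\<^sub>R z') \<le> ereal (s * a + t * a')"
    by (rule convex_fun_ereal_le[OF H 1(2) 2(2) st])
  moreover have "R (s *\<^sub>R x + t *\<^sub>R x') \<le> ereal (s * b + t * b')"
    by (rule convex_fun_ereal_le[OF R 1(3) 2(3) st])
  moreover have "s *\<^sub>R P + t *\<^sub>R Q =
      ((s *\<^sub>R z + t *\<^sub>R z') - blinfun_apply A (s *\<^sub>R x + t *\<^sub>R x'),
       c * (s * a + t * a') + (s * b + t * b'))"
    by (simp add: 1 2 blinfun.add_right blinfun.scaleR_right algebra_simps)
  ultimately show "s *\<^sub>R P + t *\<^sub>R Q \<in> ?E"
    by blast
qed

lemma fenchel_young:
  "ereal (pair q x) \<le> fenchel_conjugate pair g q + g x" if "g x \<noteq> -\<infinity>"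
proof -
  have "ereal (pair q x) - g x \<le> fenchel_conjugate pair g q"
    unfolding fenchel_conjugate_def by (rule SUP_upper) simp
  with that show ?thesis
    by (cases "g x"; cases "fenchel_conjugate pair g q") auto
qed

lemma proper_fun_conjugate:
  assumes "proper_fun g" shows "fenchel_conjugate pair g q \<noteq> -\<infinity>"
proof -
  obtain x where "g x \<noteq> \<infinity>" "g x \<noteq> -\<infinity>"
    using assms by (auto simp: proper_fun_def)
  then show ?thesis using fenchel_young[of g x pair q] by (cases "g x") auto
qed

lemma primal_minimum_finite:
  assumes H: "proper_fun H" and R: "proper_fun R" and \<alpha>: "\<alpha> > 0"
    and min: "is_arg_min (primal_objective H R A \<alpha>) (\<lambda>_. True) u"
    and u0: "H (blinfun_apply A u0) < \<infinity>" "R u0 < \<infinity>"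
  shows "\<bar>H (blinfun_apply A u)\<bar> \<noteq> \<infinity>" "\<bar>R u\<bar> \<noteq> \<infinity>"
proof -
  have "primal_objective H R A \<alpha> u \<le> primal_objective H R A \<alpha> u0"
    using min by (auto simp: is_arg_min_def not_less)
  also have "\<dots> < \<infinity>"
    using u0 H R by (cases "H (blinfun_apply A u0)"; cases "R u0")
      (auto simp: primal_objective_def proper_fun_def)
  finally have *: "ereal (1 / \<alpha>) * H (blinfun_apply A u) + R u < \<infinity>"
    by (simp add: primal_objective_def)
  have nm: "H (blinfun_apply A u) \<noteq> -\<infinity>" "R u \<noteq> -\<infinity>"
    using H R by (auto simp: proper_fun_def)
  then show "\<bar>H (blinfun_apply A u)\<bar> \<noteq> \<infinity>" "\<bar>R u\<bar> \<noteq> \<infinity>"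
    using * \<alpha> by (cases "H (blinfun_apply A u)"; cases "R u"; simp)+
qed

text \<open>An affine minorant \<open>m + l\<close> of the perturbed values satisfies
  \<open>m + l z - l (A x) \<le> H z / \<alpha> + R x\<close> for all \<open>z\<close> and \<open>x\<close>. Maximizing over \<open>x\<close> and then over \<open>z\<close>
  turns this into an upper bound for the dual objective at \<open>- l\<close>.\<close>

lemma dual_attains_primal_minimum:
  fixes A :: "'x::real_normed_vector \<Rightarrow>\<^sub>L 'y::real_normed_vector"
  assumes H: "proper_fun H" "convex_fun H" and R: "proper_fun R" "convex_fun R" and \<alpha>: "\<alpha> > 0"
    and u0: "H (blinfun_apply A u0) < \<infinity>" "R u0 < \<infinity>" "isCont H (blinfun_apply A u0)"
    and min: "is_arg_min (primal_objective H R A \<alpha>) (\<lambda>_. True) u"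
  obtains l where "dual_objective H R A \<alpha> l \<le> - primal_objective H R A \<alpha> u"
proof -
  note fin = primal_minimum_finite[OF H(1) R(1) \<alpha> min u0(1,2)]
  obtain m where m: "primal_objective H R A \<alpha> u = ereal m"
    using fin by (cases "H (blinfun_apply A u)"; cases "R u") (auto simp: primal_objective_def)
  define E where "E = {(z - blinfun_apply A x, (1 / \<alpha>) * a + b) | z x a b. H z \<le> ereal a \<and> R x \<le> ereal b}"
  have convE: "convex E"
    unfolding E_def using \<alpha> by (intro convex_value_set H(2) R(2)) simp
  have above: "m \<le> r" if "(0, r) \<in> E" for r
  proof -
    obtain z x a b where "(0, r) = (z - blinfun_apply A x, (1 / \<alpha>) * a + b)"
      and ab: "H z \<le> ereal a" "R x \<le> ereal b"
      using \<open>(0, r) \<in> E\<close> unfolding E_def by blast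
    then have r: "r = (1 / \<alpha>) * a + b" "H (blinfun_apply A x) \<le> ereal a" "R x \<le> ereal b"
      by auto
    have "ereal m \<le> primal_objective H R A \<alpha> x"
      using min m by (auto simp: is_arg_min_def not_less)
    also have "\<dots> \<le> ereal (1 / \<alpha>) * ereal a + ereal b"
      unfolding primal_objective_def using r \<alpha> by (intro add_mono ereal_mult_left_mono) auto
    finally show ?thesis using r(1) by simp
  qed
  obtain h r where hr: "H (blinfun_apply A u0) = ereal h" "R u0 = ereal r"
    using u0(1,2) H(1) R(1) by (cases "H (blinfun_apply A u0)"; cases "R u0") (auto simp: proper_fun_def)
  have "eventually (\<lambda>y. H y < ereal (h + 1)) (at (blinfun_apply A u0))"
    using u0(3) hr(1) by (intro order_tendstoD(2)[of H "ereal h"]) (auto simp: isCont_def)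
  then obtain e where e: "e > 0"
    "\<And>y. y \<noteq> blinfun_apply A u0 \<Longrightarrow> dist y (blinfun_apply A u0) < e \<Longrightarrow> H y < ereal (h + 1)"
    by (auto simp: eventually_at)
  have near: "H y \<le> ereal (h + 1)" if "dist y (blinfun_apply A u0) < e" for y
    using e(2)[OF _ that] hr(1) by (cases "y = blinfun_apply A u0") (auto intro: less_imp_le)
  have ball: "(y, (1 / \<alpha>) * (h + 1) + r) \<in> E" if "norm y < e" for y
  proof -
    have "H (blinfun_apply A u0 + y) \<le> ereal (h + 1)"
      using that by (intro near) (simp add: dist_norm)
    moreover have "(y, (1 / \<alpha>) * (h + 1) + r) =
        ((blinfun_apply A u0 + y) - blinfun_apply A u0, (1 / \<alpha>) * (h + 1) + r)"
      by simp
    ultimately show ?thesis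
      unfolding E_def using hr(2) by (blast intro: eq_refl)
  qed
  obtain l where l: "\<And>y r. (y, r) \<in> E \<Longrightarrow> m + blinfun_apply l y \<le> r"
    using convex_set_affine_minorant[OF convE above e(1) ball] by blast
  have key: "m + blinfun_apply l z - blinfun_apply l (blinfun_apply A x) \<le> (1 / \<alpha>) * a + b"
    if "H z = ereal a" "R x = ereal b" for z x a b
  proof -
    have "(z - blinfun_apply A x, (1 / \<alpha>) * a + b) \<in> E"
      unfolding E_def using that by (blast intro: eq_refl)
    from l[OF this] show ?thesis by (simp add: blinfun.diff_right)
  qed
  let ?H' = "fenchel_conjugate blinfun_apply H (\<alpha> *\<^sub>R l)"
  let ?R' = "fenchel_conjugate blinfun_apply R (adjoint_op A (- l))"
  have R'_le: "?R' \<le> ereal ((1 / \<alpha>) * a - m - blinfun_apply l z)" if "H z = ereal a" for z a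
    unfolding fenchel_conjugate_def
  proof (rule SUP_least)
    fix x
    show "ereal (blinfun_apply (adjoint_op A (- l)) x) - R x \<le> ereal ((1 / \<alpha>) * a - m - blinfun_apply l z)"
      using key[OF that, of x] R(1)
      by (cases "R x") (auto simp: adjoint_op_def proper_fun_def blinfun.minus_left)
  qed
  obtain c where c: "?R' = ereal c"
    using R'_le[OF hr(1)] proper_fun_conjugate[OF R(1), of blinfun_apply "adjoint_op A (- l)"]
    by (cases ?R') auto
  have "?H' \<le> ereal (\<alpha> * (- m - c))"
    unfolding fenchel_conjugate_def
  proof (rule SUP_least)
    fix z
    show "ereal (blinfun_apply (\<alpha> *\<^sub>R l) z) - H z \<le> ereal (\<alpha> * (- m - c))"
    proof (cases "H z")
      case (real a)
      have "c \<le> (1 / \<alpha>) * a - m - blinfun_apply l z"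
        using R'_le[OF real] c by simp
      then have "\<alpha> * c \<le> \<alpha> * ((1 / \<alpha>) * a - m - blinfun_apply l z)"
        using \<alpha> by (intro mult_left_mono) auto
      then show ?thesis
        using real \<alpha> by (simp add: blinfun.scaleR_left algebra_simps)
    qed (use H(1) in \<open>auto simp: proper_fun_def\<close>)
  qed
  then have "ereal (1 / \<alpha>) * ?H' \<le> ereal (1 / \<alpha>) * ereal (\<alpha> * (- m - c))"
    using \<alpha> by (intro ereal_mult_left_mono) auto
  also have "\<dots> = ereal (- m - c)" using \<alpha> by simp
  finally have "ereal (1 / \<alpha>) * ?H' + ?R' \<le> ereal (- m - c) + ereal c"
    unfolding c by (rule add_right_mono)
  then have "dual_objective H R A \<alpha> (- l) \<le> - primal_objective H R A \<alpha> u"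
    by (simp add: dual_objective_def m)
  then show thesis by (rule that)
qed

text \<open>Without a gap, the Fenchel--Young inequalities for \<open>H\<close> and for \<open>R\<close> add up to an equality, so
  each is an equality; the one for \<open>R\<close> says that \<open>A\<^sup>* p\<close> is a subgradient.\<close>

lemma dual_minimizer_subgradient:
  fixes A :: "'x::real_normed_vector \<Rightarrow>\<^sub>L 'y::real_normed_vector"
  assumes H: "proper_fun H" "convex_fun H" and R: "proper_fun R" "convex_fun R" and \<alpha>: "\<alpha> > 0"
    and u0: "H (blinfun_apply A u0) < \<infinity>" "R u0 < \<infinity>" "isCont H (blinfun_apply A u0)"
    and u: "is_arg_min (primal_objective H R A \<alpha>) (\<lambda>_. True) u"
    and p: "is_arg_min (dual_objective H R A \<alpha>) (\<lambda>_. True) p"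
  shows "adjoint_op A p \<in> subdifferential R u"
proof -
  let ?H' = "fenchel_conjugate blinfun_apply H (- \<alpha> *\<^sub>R p)"
  let ?R' = "fenchel_conjugate blinfun_apply R (adjoint_op A p)"
  note fin = primal_minimum_finite[OF H(1) R(1) \<alpha> u u0(1,2)]
  obtain h r where hr: "H (blinfun_apply A u) = ereal h" "R u = ereal r"
    using fin by (cases "H (blinfun_apply A u)"; cases "R u") auto
  obtain l where "dual_objective H R A \<alpha> l \<le> - primal_objective H R A \<alpha> u"
    using dual_attains_primal_minimum[OF H R \<alpha> u0 u] by blast
  moreover have "dual_objective H R A \<alpha> p \<le> dual_objective H R A \<alpha> l"
    using p by (auto simp: is_arg_min_def not_less)
  ultimately have "dual_objective H R A \<alpha> p \<le> - primal_objective H R A \<alpha> u"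
    by (rule order_trans[rotated])
  then have gap: "ereal (1 / \<alpha>) * ?H' + ?R' \<le> ereal (- (1 / \<alpha>) * h - r)"
    by (simp add: dual_objective_def primal_objective_def hr)
  have nm: "?H' \<noteq> -\<infinity>" "?R' \<noteq> -\<infinity>"
    by (rule proper_fun_conjugate[OF H(1)], rule proper_fun_conjugate[OF R(1)])
  obtain h' r' where hr': "?H' = ereal h'" "?R' = ereal r'"
    using gap nm \<alpha> by (cases ?H'; cases ?R') auto
  have "blinfun_apply (- \<alpha> *\<^sub>R p) (blinfun_apply A u) \<le> h' + h"
    using fenchel_young[of H "blinfun_apply A u" blinfun_apply "- \<alpha> *\<^sub>R p"] hr hr' by simp
  then have "- \<alpha> * blinfun_apply p (blinfun_apply A u) \<le> h' + h"
    by (simp add: blinfun.scaleR_left blinfun.minus_left)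
  then have "- blinfun_apply p (blinfun_apply A u) \<le> (1 / \<alpha>) * h' + (1 / \<alpha>) * h"
    using \<alpha> by (simp add: field_simps)
  moreover have "(1 / \<alpha>) * h' + r' \<le> - (1 / \<alpha>) * h - r"
    using gap unfolding hr' by simp
  ultimately have eq: "r' + r \<le> blinfun_apply p (blinfun_apply A u)"
    by simp
  have "R u + ereal (blinfun_apply (adjoint_op A p) (x - u)) \<le> R x" for x
  proof (cases "R x")
    case (real s)
    then have "blinfun_apply p (blinfun_apply A x) \<le> r' + s"
      using fenchel_young[of R x blinfun_apply "adjoint_op A p"] hr' by (simp add: adjoint_op_def)
    then show ?thesis
      using eq real hr by (simp add: adjoint_op_def blinfun.diff_right)
  qed (use R(1) in \<open>auto simp: proper_fun_def\<close>)
  then show ?thesis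
    using fin by (simp add: subdifferential_def)
qed

section \<open>The higher order estimate\<close>

text \<open>Pointwise \<open>b \<bar>d\<bar> \<le> c d\<^sup>2 + b\<^sup>2 / (4 c)\<close>, which is \<open>(2 c \<bar>d\<bar> - b)\<^sup>2 \<ge> 0\<close>; finiteness of the
  measure makes the constant integrable.\<close>

lemma integral_mult_le_young:
  fixes h d :: "'a \<Rightarrow> real"
  assumes fin: "finite_measure M"
    and hd: "integrable M (\<lambda>t. h t * d t)" and dd: "integrable M (\<lambda>t. (d t)\<^sup>2)"
    and b: "AE t in M. \<bar>h t\<bar> \<le> b" and c: "c > 0"
  shows "(LINT t|M. h t * d t) \<le> c * (LINT t|M. (d t)\<^sup>2) + b\<^sup>2 / (4 * c) * measure M (space M)"
proof -
  interpret finite_measure M by (rule fin)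
  have pointwise: "h t * d t \<le> c * (d t)\<^sup>2 + b\<^sup>2 / (4 * c)" if "\<bar>h t\<bar> \<le> b" for t
  proof -
    have "0 \<le> (2 * c * \<bar>d t\<bar> - b)\<^sup>2" by simp
    then have "b * \<bar>d t\<bar> * (4 * c) \<le> (c * (d t)\<^sup>2) * (4 * c) + b\<^sup>2"
      by (simp add: power2_diff algebra_simps power2_eq_square)
    then have "b * \<bar>d t\<bar> \<le> c * (d t)\<^sup>2 + b\<^sup>2 / (4 * c)"
      using c by (simp add: field_simps)
    moreover have "h t * d t \<le> b * \<bar>d t\<bar>"
      using mult_right_mono[OF that, of "\<bar>d t\<bar>"] abs_ge_self[of "h t * d t"] by (simp add: abs_mult)
    ultimately show ?thesis by linarith
  qed
  have "(LINT t|M. h t * d t) \<le> (LINT t|M. c * (d t)\<^sup>2 + b\<^sup>2 / (4 * c))"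
    using hd dd b pointwise by (intro integral_mono_AE) auto
  also have "\<dots> = c * (LINT t|M. (d t)\<^sup>2) + b\<^sup>2 / (4 * c) * measure M (space M)"
    using dd by (subst Bochner_Integration.integral_add) (auto simp: mult.commute)
  finally show ?thesis .
qed

text \<open>A real upper bound rules out an infinite norm, so that the extended inequality becomes one
  between Bochner integrals.\<close>

lemma L2_norm_sq_finite:
  assumes d: "d \<in> borel_measurable (lebesgue_on \<Gamma>)"
    and le: "ereal c * L2_norm_sq \<Gamma> d \<le> ereal b" and c: "c > 0"
  shows "integrable (lebesgue_on \<Gamma>) (\<lambda>t. (d t)\<^sup>2)"
    and "c * (LINT t|lebesgue_on \<Gamma>. (d t)\<^sup>2) \<le> b"
proof -
  have fin: "(\<integral>\<^sup>+ t. ennreal ((d t)\<^sup>2) \<partial>lebesgue_on \<Gamma>) < \<infinity>"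
  proof (rule ccontr)
    assume "\<not> ?thesis"
    then have "L2_norm_sq \<Gamma> d = \<infinity>"
      by (simp add: L2_norm_sq_def not_less top_unique)
    with le c show False by simp
  qed
  show int: "integrable (lebesgue_on \<Gamma>) (\<lambda>t. (d t)\<^sup>2)"
    using d fin by (intro integrableI_nonneg) auto
  have "L2_norm_sq \<Gamma> d = ereal (LINT t|lebesgue_on \<Gamma>. (d t)\<^sup>2)"
    unfolding L2_norm_sq_def using int by (subst nn_integral_eq_integral) auto
  with le show "c * (LINT t|lebesgue_on \<Gamma>. (d t)\<^sup>2) \<le> b" by simp
qed

lemma bidual_embed_apply: "blinfun_apply (bidual_embed y) q = blinfun_apply q y"
  unfolding bidual_embed_def
  by (simp add: bounded_linear_Blinfun_apply)

text \<open>The subgradient inequality at \<open>u\<close>, tested at the competitor \<open>w\<close>, replaces \<open>g u - g w\<close> by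
  \<open>\<xi>' (u - w)\<close>; where \<open>g w\<close> is infinite there is nothing to compare.\<close>

lemma bregman_le_via_subgradient:
  assumes \<xi>': "\<xi>' \<in> subdifferential g u" and v: "\<bar>g v\<bar> \<noteq> \<infinity>"
    and g: "proper_fun g" and le: "blinfun_apply (\<xi>' - \<xi>) (u - w) \<le> r"
  shows "bregman g \<xi> u v \<le> bregman g \<xi> w v + ereal r"
proof -
  obtain a b where ab: "g u = ereal a" "g v = ereal b"
    using \<xi>' v by (cases "g u"; cases "g v") (auto simp: subdifferential_def)
  have sub: "g u + ereal (blinfun_apply \<xi>' (w - u)) \<le> g w"
    using \<xi>' by (simp add: subdifferential_def)
  show ?thesis
  proof (cases "g w")
    case (real c)
    have "a - c \<le> blinfun_apply \<xi>' (u - w)"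
      using sub ab real by (simp add: blinfun.diff_right)
    then show ?thesis
      using le ab real by (simp add: bregman_def blinfun.diff_right blinfun.diff_left)
  qed (use g ab in \<open>auto simp: bregman_def proper_fun_def\<close>)
qed

theorem theorem6p1:
  fixes \<Gamma> :: "(real^2) set"
    and ev :: "'y::banach \<Rightarrow> real^2 \<Rightarrow> real"
    and A :: "'x::banach \<Rightarrow>\<^sub>L 'y"
    and f :: 'y
    and \<phi> :: "real^2 \<Rightarrow> real \<Rightarrow> ereal"
    and H :: "'y \<Rightarrow> ereal"
    and R :: "'x \<Rightarrow> ereal"
    and u_dag v_dag :: 'x
    and u :: "real \<Rightarrow> 'x"
    and P_dag :: "'y \<Rightarrow>\<^sub>L real" and p_dag :: "real^2 \<Rightarrow> real"
    and P :: "real \<Rightarrow> ('y \<Rightarrow>\<^sub>L real)" and p :: "real \<Rightarrow> real^2 \<Rightarrow> real"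
    and \<zeta>_dag :: "real \<Rightarrow> (('y \<Rightarrow>\<^sub>L real) \<Rightarrow>\<^sub>L real)"
    and U :: "real^2 \<Rightarrow> real set"
  assumes Gamma: "bounded \<Gamma>" "\<Gamma> \<in> sets lebesgue"
    and Y: "function_space \<Gamma> ev"
    and phi: "\<And>t. t \<in> \<Gamma> \<Longrightarrow> proper_fun (\<phi> t) \<and> convex_fun (\<phi> t) \<and> lsc_fun (\<phi> t)"
    and phi_meas: "\<And>z. (\<lambda>t. \<phi> t (ev z t)) \<in> borel_measurable (lebesgue_on \<Gamma>)"
    and H_def: "H = data_fidelity \<Gamma> ev \<phi>"
    and H: "proper_fun H" "convex_fun H" "lsc_fun H"
    and R: "proper_fun R" "convex_fun R" "lsc_fun R"
    and u_dag: "is_arg_min R (\<lambda>w. blinfun_apply A w = f) u_dag"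
    and u: "\<And>\<alpha>. \<alpha> > 0 \<Longrightarrow> is_arg_min (primal_objective H R A \<alpha>) (\<lambda>_. True) (u \<alpha>)"
    and qualification: "\<exists>u0. H (blinfun_apply A u0) < \<infinity> \<and> R u0 < \<infinity> \<and> isCont H (blinfun_apply A u0)"
    and P: "\<And>\<alpha>. \<alpha> > 0 \<Longrightarrow> is_arg_min (dual_objective H R A \<alpha>) (\<lambda>_. True) (P \<alpha>)"
    and p: "\<And>\<alpha>. \<alpha> > 0 \<Longrightarrow> represented_by \<Gamma> ev (P \<alpha>) (p \<alpha>)"
    and C1: "AE t in lebesgue_on \<Gamma>.
        \<exists>V. open V \<and> ev f t \<in> V \<and> times_differentiable_on 3 (\<phi> t) V"
    and C2: "AE t in lebesgue_on \<Gamma>. ederiv 1 (\<phi> t) (ev f t) = 0 \<and> ederiv 2 (\<phi> t) (ev f t) \<noteq> 0"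
    and C3: "\<exists>Ct. AE t in lebesgue_on \<Gamma>.
        open (U t) \<and> ev f t \<in> U t \<and> times_differentiable_on 3 (\<phi> t) (U t) \<and>
        (\<forall>z\<in>U t. ederiv 2 (\<phi> t) z \<noteq> 0 \<and>
                  \<bar>ederiv 3 (\<phi> t) z / (ederiv 2 (\<phi> t) z) ^ 3\<bar> \<le> Ct)"
    and P_dag: "represented_by \<Gamma> ev P_dag p_dag" "\<exists>M. AE t in lebesgue_on \<Gamma>. \<bar>p_dag t\<bar> \<le> M"
    and source: "adjoint_op A P_dag \<in> subdifferential R u_dag"
      "AE t in lebesgue_on \<Gamma>.
         p_dag t / ederiv 2 (\<phi> t) (ev f t) = ev (blinfun_apply A v_dag) t"
    and uniform_U: "\<exists>\<alpha>0>0. AE t in lebesgue_on \<Gamma>. \<forall>\<alpha>\<in>{0<..<\<alpha>0}.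
         - \<alpha> * p_dag t \<in> ederiv 1 (\<phi> t) ` U t"
    and zeta_dag: "\<forall>\<^sub>F \<alpha> in at_right 0.
         \<zeta>_dag \<alpha> \<in> subdifferential (fenchel_conjugate blinfun_apply H) (- \<alpha> *\<^sub>R P_dag) \<and>
         integrable (lebesgue_on \<Gamma>) (\<lambda>t.
           ederiv 1 (fenchel_conjugate (*) (\<phi> t)) (- \<alpha> * p_dag t) * (p \<alpha> t - p_dag t)) \<and>
         blinfun_apply (\<zeta>_dag \<alpha>) (P \<alpha> - P_dag) = (LINT t|lebesgue_on \<Gamma>.
           ederiv 1 (fenchel_conjugate (*) (\<phi> t)) (- \<alpha> * p_dag t) * (p \<alpha> t - p_dag t))"
    and D_sym: "\<exists>C>0. \<forall>\<^sub>F \<alpha> in at_right 0.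
         ereal (sym_bregman (bidual_embed (blinfun_apply A (u \<alpha>))) (\<zeta>_dag \<alpha>)
                  (- \<alpha> *\<^sub>R P \<alpha>) (- \<alpha> *\<^sub>R P_dag))
           \<ge> ereal (C * \<alpha>\<^sup>2) * L2_norm_sq \<Gamma> (\<lambda>t. p \<alpha> t - p_dag t)"
  shows "\<exists>r. r \<in> O[at_right 0](\<lambda>\<alpha>::real. \<alpha> ^ 3) \<and>
           (\<forall>\<^sub>F \<alpha> in at_right 0.
              bregman R (adjoint_op A P_dag) (u \<alpha>) u_dag
                \<le> bregman R (adjoint_op A P_dag) (u_dag - \<alpha> *\<^sub>R v_dag) u_dag + ereal (r \<alpha>))"
proof -
  let ?M = "lebesgue_on \<Gamma>"
  let ?G = "\<lambda>\<alpha> t. ederiv 1 (fenchel_conjugate (*) (\<phi> t)) (- \<alpha> * p_dag t)"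
  have finM: "finite_measure ?M"
    using Gamma by (intro finite_measure_lebesgue_on lmeasurable_iff_integrable bounded_set_imp_lmeasurable) auto
  obtain Ct where Ct: "AE t in ?M. open (U t) \<and> ev f t \<in> U t \<and> times_differentiable_on 3 (\<phi> t) (U t) \<and>
      (\<forall>z\<in>U t. ederiv 2 (\<phi> t) z \<noteq> 0 \<and> \<bar>ederiv 3 (\<phi> t) z / (ederiv 2 (\<phi> t) z) ^ 3\<bar> \<le> Ct)"
    using C3 by blast
  obtain B where B: "AE t in ?M. \<bar>p_dag t\<bar> \<le> B" using P_dag(2) by blast
  obtain \<alpha>0 where \<alpha>0: "\<alpha>0 > 0"
    "AE t in ?M. \<forall>\<alpha>\<in>{0<..<\<alpha>0}. - \<alpha> * p_dag t \<in> ederiv 1 (\<phi> t) ` U t"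
    using uniform_U by blast
  obtain C where C: "C > 0" "\<forall>\<^sub>F \<alpha> in at_right 0.
      ereal (sym_bregman (bidual_embed (blinfun_apply A (u \<alpha>))) (\<zeta>_dag \<alpha>)
                  (- \<alpha> *\<^sub>R P \<alpha>) (- \<alpha> *\<^sub>R P_dag))
           \<ge> ereal (C * \<alpha>\<^sup>2) * L2_norm_sq \<Gamma> (\<lambda>t. p \<alpha> t - p_dag t)"
    using D_sym by blast
  obtain u0 where u0: "H (blinfun_apply A u0) < \<infinity>" "R u0 < \<infinity>" "isCont H (blinfun_apply A u0)"
    using qualification by blast
  define K where "K = \<bar>Ct\<bar> / 2 * B\<^sup>2"
  have taylor: "AE t in ?M. \<bar>?G \<alpha> t - ev f t + \<alpha> * ev (blinfun_apply A v_dag) t\<bar> \<le> K * \<alpha>\<^sup>2"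
    if \<alpha>: "0 < \<alpha>" "\<alpha> < \<alpha>0" for \<alpha>
    using AE_space Ct B \<alpha>0(2) C2 source(2)
  proof eventually_elim
    case (elim t)
    have t: "t \<in> \<Gamma>" using elim(1) by simp
    interpret smooth_convex_integrand "\<phi> t" "U t"
      using phi[OF t] elim(2) by unfold_locales auto
    have "\<bar>?G \<alpha> t - ev f t + \<alpha> * (p_dag t / ederiv 2 (\<phi> t) (ev f t))\<bar> \<le> \<bar>Ct\<bar> / 2 * (\<alpha> * p_dag t)\<^sup>2"
    proof (rule conjugate_deriv_taylor[of "ev f t" "\<bar>Ct\<bar>" \<alpha>0 "p_dag t" \<alpha>])
      show "\<bar>ederiv 3 (\<phi> t) w / (ederiv 2 (\<phi> t) w) ^ 3\<bar> \<le> \<bar>Ct\<bar>" if "w \<in> U t" for w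
        using elim(2) that abs_ge_self[of Ct] order_trans by blast
    qed (use elim \<alpha> in auto)
    also have "\<dots> \<le> \<bar>Ct\<bar> / 2 * (\<alpha>\<^sup>2 * B\<^sup>2)"
      using power_mono[OF elim(3), of 2]
      by (intro mult_left_mono) (auto simp: power_mult_distrib intro!: mult_left_mono)
    finally show ?case
      using elim(6) by (simp add: K_def mult_ac)
  qed
  (* The remainder in Young's inequality with b = K \<alpha>^2 and c = C \<alpha>, integrated and divided by \<alpha>^3. *)
  define D where "D = K\<^sup>2 / (4 * C) * measure ?M (space ?M)"
  show ?thesis
  proof (intro exI conjI)
    show "(\<lambda>\<alpha>. D * \<alpha> ^ 3) \<in> O[at_right 0](\<lambda>\<alpha>::real. \<alpha> ^ 3)"
      by (cases "D = 0") simp_all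
    have small: "\<forall>\<^sub>F \<alpha> in at_right 0. \<alpha> \<in> {0<..<\<alpha>0}"
      using \<alpha>0(1) by (rule eventually_at_right_real)
    show "\<forall>\<^sub>F \<alpha> in at_right 0.
              bregman R (adjoint_op A P_dag) (u \<alpha>) u_dag
                \<le> bregman R (adjoint_op A P_dag) (u_dag - \<alpha> *\<^sub>R v_dag) u_dag + ereal (D * \<alpha> ^ 3)"
      using small zeta_dag C(2)
    proof eventually_elim
      case (elim \<alpha>)
      have \<alpha>: "0 < \<alpha>" "\<alpha> < \<alpha>0" using elim(1) by auto
      define W where "W = P \<alpha> - P_dag"
      define d where "d t = p \<alpha> t - p_dag t" for t
      define h where "h t = ?G \<alpha> t - ev f t + \<alpha> * ev (blinfun_apply A v_dag) t" for t
      define N where "N = (LINT t|?M. (d t)\<^sup>2)"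
      have rep: "represented_by \<Gamma> ev W d"
        using p[OF \<alpha>(1)] P_dag(1)
        by (auto simp: represented_by_def W_def d_def[abs_def] blinfun.diff_left right_diff_distrib)
      then have d_meas: "d \<in> borel_measurable ?M"
        and W: "integrable ?M (\<lambda>t. ev z t * d t)" "blinfun_apply W z = (LINT t|?M. ev z t * d t)" for z
        by (auto simp: represented_by_def)
      have G: "integrable ?M (\<lambda>t. ?G \<alpha> t * d t)"
        "blinfun_apply (\<zeta>_dag \<alpha>) W = (LINT t|?M. ?G \<alpha> t * d t)"
        using elim(2) by (auto simp: W_def d_def)
      have sym: "sym_bregman (bidual_embed (blinfun_apply A (u \<alpha>))) (\<zeta>_dag \<alpha>) (- \<alpha> *\<^sub>R P \<alpha>) (- \<alpha> *\<^sub>R P_dag)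
          = - \<alpha> * (blinfun_apply W (blinfun_apply A (u \<alpha>)) - blinfun_apply (\<zeta>_dag \<alpha>) W)"
      proof -
        have "- \<alpha> *\<^sub>R P \<alpha> - - \<alpha> *\<^sub>R P_dag = - \<alpha> *\<^sub>R W"
          by (simp add: W_def scaleR_diff_right)
        then show ?thesis
          by (simp only: sym_bregman_def blinfun.diff_left blinfun.scaleR_right bidual_embed_apply)
             (simp add: algebra_simps)
      qed
      have L2: "ereal (C * \<alpha>\<^sup>2) * L2_norm_sq \<Gamma> d
          \<le> ereal (- \<alpha> * (blinfun_apply W (blinfun_apply A (u \<alpha>)) - blinfun_apply (\<zeta>_dag \<alpha>) W))"
        using elim(3) unfolding sym d_def[abs_def] .
      have C\<alpha>: "C * \<alpha>\<^sup>2 > 0" using C(1) \<alpha> by simp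
      note d2 = L2_norm_sq_finite[OF d_meas L2 C\<alpha>]
      (* The symmetric Bregman distance carries a factor \<alpha>; dividing it out leaves C \<alpha> N. *)
      have "\<alpha> * (C * \<alpha> * N) \<le> \<alpha> * (blinfun_apply (\<zeta>_dag \<alpha>) W - blinfun_apply W (blinfun_apply A (u \<alpha>)))"
        using d2(2) unfolding N_def by (simp add: power2_eq_square algebra_simps)
      then have coercive: "blinfun_apply W (blinfun_apply A (u \<alpha>)) \<le> blinfun_apply (\<zeta>_dag \<alpha>) W - C * \<alpha> * N"
        using \<alpha>(1) by simp
      have hd: "integrable ?M (\<lambda>t. h t * d t)"
        "(LINT t|?M. h t * d t) = blinfun_apply (\<zeta>_dag \<alpha>) W - blinfun_apply W f
           + \<alpha> * blinfun_apply W (blinfun_apply A v_dag)"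
      proof -
        have eq: "h t * d t = ?G \<alpha> t * d t - ev f t * d t + \<alpha> * (ev (blinfun_apply A v_dag) t * d t)" for t
          by (simp add: h_def algebra_simps)
        show "integrable ?M (\<lambda>t. h t * d t)"
          unfolding eq using G(1) W(1) by auto
        show "(LINT t|?M. h t * d t) = blinfun_apply (\<zeta>_dag \<alpha>) W - blinfun_apply W f
           + \<alpha> * blinfun_apply W (blinfun_apply A v_dag)"
          unfolding eq G(2) W(2) using G(1) W(1) by simp
      qed
      have "(LINT t|?M. h t * d t)
          \<le> C * \<alpha> * N + (K * \<alpha>\<^sup>2)\<^sup>2 / (4 * (C * \<alpha>)) * measure ?M (space ?M)"
        unfolding N_def using taylor[OF \<alpha>] C(1) \<alpha>
        by (intro integral_mult_le_young[OF finM hd(1) d2(1)]) (auto simp: h_def)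
      also have "(K * \<alpha>\<^sup>2)\<^sup>2 / (4 * (C * \<alpha>)) * measure ?M (space ?M) = D * \<alpha> ^ 3"
        unfolding D_def using \<alpha> C(1) by (simp add: field_simps eval_nat_numeral)
      finally have "blinfun_apply W (blinfun_apply A (u \<alpha>)) - blinfun_apply W f
           + \<alpha> * blinfun_apply W (blinfun_apply A v_dag) \<le> D * \<alpha> ^ 3"
        using coercive hd(2) by linarith
      moreover have "f = blinfun_apply A u_dag"
        using u_dag by (simp add: is_arg_min_def)
      ultimately have le: "blinfun_apply (adjoint_op A (P \<alpha>) - adjoint_op A P_dag)
          (u \<alpha> - (u_dag - \<alpha> *\<^sub>R v_dag)) \<le> D * \<alpha> ^ 3"
        by (simp add: adjoint_op_def W_def blinfun.diff_left blinfun.diff_right blinfun.add_right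
            blinfun.scaleR_right algebra_simps)
      show ?case
      proof (rule bregman_le_via_subgradient[OF _ _ R(1) le])
        show "adjoint_op A (P \<alpha>) \<in> subdifferential R (u \<alpha>)"
          by (rule dual_minimizer_subgradient[OF H(1,2) R(1,2) \<alpha>(1) u0 u[OF \<alpha>(1)] P[OF \<alpha>(1)]])
        show "\<bar>R u_dag\<bar> \<noteq> \<infinity>"
          using source(1) by (simp add: subdifferential_def)
      qed
    qed
  qed
qed

end
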